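(* Let $J\in\mathbb N^*$ and let $\sigma_+^1(z_0),\dots,\sigma_+^J(z_0)>0$ be the local classical densities at a point $z_0$ (see context). Let $G_{z_0}=\prod_{j=1}^Jg^j$ with $g^1,\dots,g^J$ independent Gaussian analytic functions on $\mathbb C$ with covariance kernels $K^j(u,\bar v)=\exp(\sigma_+^j(z_0)u\bar v)$, and let $d^{k,V}_{z_0}$ be the $k$-point density of its zero point process, given by $$d^{k,V}_{z_0}(w_1,\dots,w_k)=\sum_{\substack{\alpha\in\mathbb N^J\\ \alpha_1+\cdots+\alpha_J=k}}\ \sum_{\tau\in\mathfrak S_k}\frac1{\alpha!}\prod_{j=1}^Jd^{\alpha_j}_{g^j}\big(w_{\tau(\alpha_1+\cdots+\alpha_{j-1}+1)},\dots,w_{\tau(\alpha_1+\cdots+\alpha_j)}\big),$$ with $d^r_{g^j}$ the $r$-point density of the zeros of $g^j$ and $d^0_{g^j}\equiv1$. Let $O\subset\mathbb C$ be a compact set and let $k>J$. Then there exists a positive constant $C=C(k,O)$ such that, for any configuration of pairwise distinct points $w_1,\dots,w_k\in O$, $$d^{k,V}_{z_0}(w_1,\dots,w_k)\le C\sum_{i<j}|w_i-w_j|^2 .$$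
   Context: In the source, $p_0:\mathbb R^2\to\mathbb C$ is the principal symbol of a nonselfadjoint semiclassical operator, symmetric in $\xi\mapsto-\xi$, and $p_0^{-1}(z_0)=\{\rho_\pm^j=(x^j,\pm\xi^j):1\le j\le J\}$ with $\pm\{\mathrm{Re}\,p_0,\mathrm{Im}\,p_0\}(\rho_\pm^j)<0$, the $x^j$ pairwise distinct; $\sigma_+^j(z_0)=1/|\{\mathrm{Re}\,p_0,\mathrm{Im}\,p_0\}(\rho_+^j)|>0$. Only the numbers $J$ and $\sigma_+^j(z_0)>0$ enter the statement; they are fixed, and $C$ may depend on them. A Gaussian analytic function (GAF) with covariance kernel $K$ is a random analytic function with centred circular complex Gaussian finite-dimensional distributions, $\mathbb E[g(u)\overline{g(v)}]=K(u,\bar v)$. The $r$-point density of the zeros of $g^j$ is, for pairwise distinct $w_1,\dots,w_r$, $$d^r_{g^j}(w)=\frac{\mathrm{perm}[C-BA^{-1}B^*]}{\det(\pi A)},\quad A_{n,m}=K^j(w_n,\bar w_m),\ B_{n,m}=(\partial_wK^j)(w_n,\bar w_m),\ C_{n,m}=(\partial^2_{w\bar w}K^j)(w_n,\bar w_m),$$ where $K^j(w,\bar w)=\exp(\sigma_+^j(z_0)w\bar w)$, $\mathrm{perm}$ is the permanent, $\mathfrak S_k$ is the symmetric group on $k$ elements and $\alpha!=\alpha_1!\cdots\alpha_J!$. *)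

theory Defs
  imports
    "HOL-Probability.Probability"
    "HOL-Complex_Analysis.Complex_Analysis"
    "HOL-Combinatorics.Permutations"
    "Jordan_Normal_Form.Schur_Decomposition"
    "Jordan_Normal_Form.Gauss_Jordan_Elimination"
    "Jordan_Normal_Form.Determinant"
begin

definition std_complex_gaussian :: "complex measure" where
  "std_complex_gaussian = density lborel (\<lambda>z. ennreal (exp (- (cmod z)\<^sup>2) / pi))"

text \<open>Centred circular complex Gaussian vectors are the linear images of finitely many
  independent standard complex Gaussians; the image may be degenerate.\<close>

definition circular_gaussian_law :: "'i set \<Rightarrow> ('i \<Rightarrow> complex) measure \<Rightarrow> bool" where
  "circular_gaussian_law I N \<longleftrightarrow>
     (\<exists>m (L :: 'i \<Rightarrow> nat \<Rightarrow> complex).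
        N = distr (Pi\<^sub>M {..<m} (\<lambda>_. std_complex_gaussian)) (Pi\<^sub>M I (\<lambda>_. borel))
              (\<lambda>y. \<lambda>i\<in>I. \<Sum>l<m. L i l * y l))"

text \<open>Kernels are functions of the two independent variables \<open>u\<close> and \<open>v\<close>, holomorphic in
  both, with the conjugate of the second point substituted for \<open>v\<close>: the value at
  \<open>u\<close> and \<open>cnj v\<close> is the covariance of \<open>g u\<close> and \<open>g v\<close>.\<close>

definition covariance_kernel ::
    "'a measure \<Rightarrow> ('a \<Rightarrow> complex \<Rightarrow> complex) \<Rightarrow> complex \<Rightarrow> complex \<Rightarrow> complex" where
  "covariance_kernel M g u v = (\<integral>\<omega>. g \<omega> u * cnj (g \<omega> (cnj v)) \<partial>M)"

definition gaussian_analytic_function ::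
    "'a measure \<Rightarrow> ('a \<Rightarrow> complex \<Rightarrow> complex) \<Rightarrow> (complex \<Rightarrow> complex \<Rightarrow> complex) \<Rightarrow> bool" where
  "gaussian_analytic_function M g K \<longleftrightarrow>
     (\<forall>\<omega>\<in>space M. g \<omega> holomorphic_on UNIV) \<and>
     (\<forall>u. (\<lambda>\<omega>. g \<omega> u) \<in> borel_measurable M) \<and>
     (\<forall>S. finite S \<longrightarrow>
        circular_gaussian_law S (distr M (Pi\<^sub>M S (\<lambda>_. borel)) (\<lambda>\<omega>. restrict (g \<omega>) S))) \<and>
     (\<forall>u v. covariance_kernel M g u v = K u v)"

definition permanent :: "complex mat \<Rightarrow> complex" where
  "permanent X = (\<Sum>\<pi> | \<pi> permutes {..<dim_row X}. \<Prod>i<dim_row X. X $$ (i, \<pi> i))"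

context
  fixes K :: "complex \<Rightarrow> complex \<Rightarrow> complex" and r :: nat and w :: "nat \<Rightarrow> complex"
begin

definition kernel_A :: "complex mat" where
  "kernel_A = Matrix.mat r r (\<lambda>(n, m). K (w n) (cnj (w m)))"

definition kernel_B :: "complex mat" where
  "kernel_B = Matrix.mat r r (\<lambda>(n, m). deriv (\<lambda>u. K u (cnj (w m))) (w n))"

definition kernel_C :: "complex mat" where
  "kernel_C = Matrix.mat r r
     (\<lambda>(n, m). deriv (\<lambda>v. deriv (\<lambda>u. K u v) (w n)) (cnj (w m)))"

text \<open>The density at \<open>w 0, \<dots>, w (r - 1)\<close>; meaningful where \<open>kernel_A\<close> is invertible. For a
  covariance kernel both \<open>kernel_A\<close> and the matrix inside the permanent are Hermitian, so the
  quotient is real and \<open>Re\<close> only changes the type.\<close>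

definition zero_density :: real where
  "zero_density =
     Re (permanent (kernel_C - kernel_B * the (mat_inverse kernel_A) * mat_adjoint kernel_B)
         / Determinant.det (complex_of_real pi \<cdot>\<^sub>m kernel_A))"

end

lemma zero_density_0: "zero_density K 0 w = 1"
  by (simp add: zero_density_def permanent_def kernel_A_def kernel_B_def kernel_C_def
      mat_adjoint_def)

text \<open>The \<open>k\<close>-point density of the zeros of the product of \<open>J\<close> independent Gaussian analytic
  functions with kernels \<open>K 0, \<dots>, K (J - 1)\<close>. Indices of kernels and of points start at 0.\<close>

definition product_zero_density ::
    "nat \<Rightarrow> (nat \<Rightarrow> complex \<Rightarrow> complex \<Rightarrow> complex) \<Rightarrow> nat \<Rightarrow> (nat \<Rightarrow> complex) \<Rightarrow> real" where
  "product_zero_density J K k w =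
     (\<Sum>\<alpha> | \<alpha> \<in> {..<J} \<rightarrow>\<^sub>E (UNIV :: nat set) \<and> (\<Sum>j<J. \<alpha> j) = k.
        \<Sum>\<tau> | \<tau> permutes {..<k}.
          1 / real (\<Prod>j<J. fact (\<alpha> j)) *
          (\<Prod>j<J. zero_density (K j) (\<alpha> j) (\<lambda>i. w (\<tau> ((\<Sum>l<j. \<alpha> l) + i)))))"

end

(* Expand the kernel as K(u,v) = sum_l a_l u^l v^l with a_l = s^l/l!. Then C - B A^{-1} B^* is the
   Gram matrix, in the sequence space weighted by a_l, of the derivative functionals at the points
   w_n after projecting off the evaluations at all the points. The length of such a projection is
   at most that of f'(w_n) minus the derivative of the interpolant of f, which is
   P_n = prod_{i \<noteq> n} |w_n - w_i| times a divided difference of f; so the permanent is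
   O((prod_n P_n)^2). On the other hand A dominates a multiple of V V^* with V the Vandermonde
   matrix, and |det V|^2 = prod_n P_n. Hence d^r = O(prod_{i<j} |w_i - w_j|^2), which is bounded
   and, for r \<ge> 2, at most a constant times |w_1 - w_0|^2. When k > J, every term of the sum over
   alpha has a factor with alpha_j \<ge> 2. *)
theory Submission
  imports Defs
begin

section \<open>Polynomial interpolation with bounds uniform in the nodes\<close>

text \<open>Newton interpolation adds one node at a time, and each node costs one division by a
  linear factor. On the circle of radius \<open>2 * R\<close> that factor has modulus at least 1, so
  by the maximum principle each division at most doubles the bound, however close the nodes are.
  \<open>Y\<close> is chosen before \<open>p\<close>, which makes the interpolant linear in the
  values of \<open>p\<close>.\<close>

lemma bounded_interpolation_remainder:
  fixes X :: "complex set" and R :: real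
  assumes "finite X" "X \<subseteq> cball 0 R" "R \<ge> 1"
  shows "\<exists>Y :: complex \<Rightarrow> complex poly. \<forall>p M. (\<forall>z\<in>cball 0 (2 * R). cmod (poly p z) \<le> M) \<longrightarrow>
    (\<exists>q. p = (\<Sum>x\<in>X. Polynomial.smult (poly p x) (Y x)) + (\<Prod>x\<in>X. [:-x, 1:]) * q \<and>
         (\<forall>z\<in>cball 0 (2 * R). cmod (poly q z) \<le> 2 ^ card X * M))"
  using assms
proof (induction X rule: finite_induct)
  case empty
  show ?case by auto
next
  case (insert a X)
  let ?P = "\<lambda>X. \<Prod>x\<in>X. [:-x, 1 :: complex:]"
  from insert obtain Y :: "complex \<Rightarrow> complex poly" where
    Y: "\<And>p M. (\<forall>z\<in>cball 0 (2 * R). cmod (poly p z) \<le> M) \<Longrightarrow>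
      \<exists>q. p = (\<Sum>x\<in>X. Polynomial.smult (poly p x) (Y x)) + ?P X * q \<and>
         (\<forall>z\<in>cball 0 (2 * R). cmod (poly q z) \<le> 2 ^ card X * M)"
    by auto
  have a: "cmod a \<le> R" using insert.prems by auto
  define c where "c = poly (?P X) a"
  have c: "c \<noteq> 0"
    using insert.hyps by (auto simp: c_def poly_prod)
  \<comment> \<open>The old interpolation polynomials are corrected so as to vanish at
    \<open>a\<close>; the new one is 1 at \<open>a\<close> and 0 on \<open>X\<close>.\<close>
  define Y' where "Y' = (\<lambda>x. if x = a then Polynomial.smult (1 / c) (?P X)
      else Y x - Polynomial.smult (poly (Y x) a / c) (?P X))"
  show ?case
  proof (intro exI[of _ Y'] allI impI)
    fix p M assume M: "\<forall>z\<in>cball 0 (2 * R). cmod (poly p z) \<le> M"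
    obtain q where q: "p = (\<Sum>x\<in>X. Polynomial.smult (poly p x) (Y x)) + ?P X * q"
      and qM: "\<And>z. z \<in> cball 0 (2 * R) \<Longrightarrow> cmod (poly q z) \<le> 2 ^ card X * M"
      using Y[OF M] by auto
    \<comment> \<open>\<open>poly q a\<close> becomes the next Newton coefficient and
      \<open>q'\<close> the new remainder.\<close>
    define q' where "q' = synthetic_div q a"
    have q': "q = [:-a, 1:] * q' + [:poly q a:]"
      unfolding q'_def by (rule synthetic_div_correct'[symmetric])
    \<comment> \<open>Since \<open>?P X\<close> has the value \<open>c\<close> at \<open>a\<close>,
      this expresses \<open>poly q a\<close> linearly through the values of \<open>p\<close> at the
      nodes, and \<open>Y'\<close> can absorb it.\<close>
    have "poly p a = (\<Sum>x\<in>X. poly p x * poly (Y x) a) + c * poly q a"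
      by (subst q) (simp add: poly_sum c_def)
    hence qa: "poly q a = (poly p a - (\<Sum>x\<in>X. poly p x * poly (Y x) a)) / c"
      using c by (simp add: field_simps)
    have "(\<Sum>x\<in>X. Polynomial.smult (poly p x) (Y' x)) =
        (\<Sum>x\<in>X. Polynomial.smult (poly p x) (Y x)
             - Polynomial.smult (poly p x * poly (Y x) a / c) (?P X))"
      using insert.hyps by (intro sum.cong) (auto simp: Y'_def smult_diff_right)
    also have "\<dots> = (\<Sum>x\<in>X. Polynomial.smult (poly p x) (Y x))
        - Polynomial.smult ((\<Sum>x\<in>X. poly p x * poly (Y x) a) / c) (?P X)"
      by (simp add: sum_subtractf smult_sum sum_divide_distrib)
    finally have S: "(\<Sum>x\<in>insert a X. Polynomial.smult (poly p x) (Y' x)) =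
        (\<Sum>x\<in>X. Polynomial.smult (poly p x) (Y x)) + Polynomial.smult (poly q a) (?P X)"
      using insert.hyps c
      by (simp add: qa Y'_def diff_divide_distrib smult_diff_left algebra_simps)
    have "p = (\<Sum>x\<in>X. Polynomial.smult (poly p x) (Y x)) + ?P X * q"
      by (rule q)
    also have "?P X * q = Polynomial.smult (poly q a) (?P X) + ?P (insert a X) * q'"
      by (subst q') (use insert.hyps in \<open>simp add: algebra_simps\<close>)
    finally have eq: "p = (\<Sum>x\<in>insert a X. Polynomial.smult (poly p x) (Y' x)) + ?P (insert a X) * q'"
      using S by (simp only: add.assoc)
    have "cmod (poly q' z) \<le> 2 ^ card (insert a X) * M" if z: "z \<in> cball 0 (2 * R)" for z
    proof (rule maximum_modulus_frontier[of "poly q'" "cball 0 (2 * R)"])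
      fix u assume "u \<in> frontier (cball 0 (2 * R) :: complex set)"
      hence u: "cmod u = 2 * R"
        using insert.prems by (simp add: frontier_cball)
      \<comment> \<open>This is why the disc has twice the radius that contains the nodes: the
        distance is at least \<open>2 * R - R\<close>.\<close>
      hence ua: "cmod (u - a) \<ge> 1"
        using norm_triangle_ineq2[of u a] a insert.prems by linarith
      have "poly q u = (u - a) * poly q' u + poly q a"
        by (subst q') (simp add: algebra_simps)
      hence "cmod (u - a) * cmod (poly q' u) = cmod (poly q u - poly q a)"
        by (simp flip: norm_mult)
      also have "\<dots> \<le> 2 ^ card X * M + 2 ^ card X * M"
        using u a insert.prems
        by (intro order.trans[OF norm_triangle_ineq4] add_mono qM) auto
      finally have "cmod (u - a) * cmod (poly q' u) \<le> 2 ^ card (insert a X) * M"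
        using insert.hyps by (simp add: mult_ac)
      moreover have "1 * cmod (poly q' u) \<le> cmod (u - a) * cmod (poly q' u)"
        using ua by (intro mult_right_mono) auto
      ultimately show "cmod (poly q' u) \<le> 2 ^ card (insert a X) * M" by simp
    qed (use z in \<open>auto intro!: holomorphic_intros continuous_intros\<close>)
    with eq show "\<exists>q. p = (\<Sum>x\<in>insert a X. Polynomial.smult (poly p x) (Y' x)) + ?P (insert a X) * q \<and>
         (\<forall>z\<in>cball 0 (2 * R). cmod (poly q z) \<le> 2 ^ card (insert a X) * M)"
      by blast
  qed
qed

text \<open>The interpolation identity for a monomial is differentiated at \<open>w n\<close>. The
  node polynomial vanishes there, so the error is its derivative, the product of the differences,
  times the value of the remainder. The coefficients \<open>y\<close> must serve all
  \<open>l\<close> at once, because they describe one linear functional. For \<open>l = 0\<close>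
  the factor \<open>of_nat l\<close> makes the truncated exponent harmless.\<close>

lemma derivative_interpolation_bound:
  fixes w :: "nat \<Rightarrow> complex" and R :: real
  assumes "inj_on w {..<r}" "\<And>i. i < r \<Longrightarrow> cmod (w i) \<le> R" "R \<ge> 1" "n < r"
  shows "\<exists>y. \<forall>l. cmod (of_nat l * w n ^ (l - 1) - (\<Sum>i<r. y i * w i ^ l))
           \<le> (\<Prod>i\<in>{..<r} - {n}. cmod (w n - w i)) * (2 ^ r * (2 * R) ^ l)"
proof -
  let ?P = "\<Prod>i<r. [:- w i, 1:]"
  from assms have "finite (w ` {..<r})" "w ` {..<r} \<subseteq> cball 0 R"
    by auto
  from bounded_interpolation_remainder[OF this \<open>R \<ge> 1\<close>] assms(1)
  obtain Y :: "complex \<Rightarrow> complex poly" where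
    Y: "\<And>p M. (\<forall>z\<in>cball 0 (2 * R). cmod (poly p z) \<le> M) \<Longrightarrow>
      \<exists>q. p = (\<Sum>i<r. Polynomial.smult (poly p (w i)) (Y (w i))) + ?P * q \<and>
         (\<forall>z\<in>cball 0 (2 * R). cmod (poly q z) \<le> 2 ^ r * M)"
    by (auto simp: sum.reindex prod.reindex card_image)
  have dP: "poly (pderiv ?P) (w n) = (\<Prod>i\<in>{..<r} - {n}. w n - w i)"
  proof -
    have "poly (pderiv ?P) (w n) = (\<Sum>k<r. \<Prod>i\<in>{..<r} - {k}. w n - w i)"
      by (simp add: pderiv_prod poly_sum poly_prod pderiv_pCons)
    \<comment> \<open>For \<open>k \<noteq> n\<close> the product contains the zero factor
      \<open>w n - w n\<close>.\<close>
    also have "\<dots> = (\<Sum>k<r. if k = n then \<Prod>i\<in>{..<r} - {n}. w n - w i else 0)"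
      using \<open>n < r\<close> by (intro sum.cong) auto
    finally show ?thesis using \<open>n < r\<close> by simp
  qed
  have P0: "poly ?P (w n) = 0"
    using \<open>n < r\<close> by (auto simp: poly_prod)
  show ?thesis
  \<comment> \<open>The witnesses are the derivatives at \<open>w n\<close> of the interpolation
    polynomials, which do not involve \<open>l\<close>.\<close>
  proof (intro exI[of _ "\<lambda>i. poly (pderiv (Y (w i))) (w n)"] allI)
    fix l
    let ?p = "Polynomial.monom (1 :: complex) l"
    have "\<forall>z\<in>cball 0 (2 * R). cmod (poly ?p z) \<le> (2 * R) ^ l"
      by (intro ballI, subst poly_monom, subst mult_1, subst norm_power, intro power_mono) auto
    from Y[OF this] obtain q where
      q: "?p = (\<Sum>i<r. Polynomial.smult (w i ^ l) (Y (w i))) + ?P * q"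
      and qb: "\<And>z. z \<in> cball 0 (2 * R) \<Longrightarrow> cmod (poly q z) \<le> 2 ^ r * (2 * R) ^ l"
      by (auto simp: poly_monom)
    have "of_nat l * w n ^ (l - 1) = poly (pderiv ?p) (w n)"
      by (simp add: pderiv_monom poly_monom)
    also have "\<dots> = (\<Sum>i<r. w i ^ l * poly (pderiv (Y (w i))) (w n))
        + (\<Prod>i\<in>{..<r} - {n}. w n - w i) * poly q (w n)"
      by (subst q) (simp add: pderiv_add pderiv_sum pderiv_smult pderiv_mult poly_sum P0 dP
          del: pderiv_prod)
    finally have "cmod (of_nat l * w n ^ (l - 1) - (\<Sum>i<r. poly (pderiv (Y (w i))) (w n) * w i ^ l))
        = (\<Prod>i\<in>{..<r} - {n}. cmod (w n - w i)) * cmod (poly q (w n))"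
      by (simp add: norm_mult prod_norm mult.commute)
    also have "\<dots> \<le> (\<Prod>i\<in>{..<r} - {n}. cmod (w n - w i)) * (2 ^ r * (2 * R) ^ l)"
      using assms(2)[OF \<open>n < r\<close>] \<open>R \<ge> 1\<close>
      by (intro mult_left_mono qb) (auto intro: prod_nonneg)
    finally show "cmod (of_nat l * w n ^ (l - 1) - (\<Sum>i<r. poly (pderiv (Y (w i))) (w n) * w i ^ l))
        \<le> (\<Prod>i\<in>{..<r} - {n}. cmod (w n - w i)) * (2 ^ r * (2 * R) ^ l)" .
  qed
qed

section \<open>Schur complements as Gram matrices\<close>

text \<open>In the inner product with weights \<open>a\<close>, the entries of \<open>A\<close>,
  \<open>B\<close>, \<open>C\<close> are the products among the vectors \<open>e n\<close> and
  \<open>d n\<close>, and the assumption on \<open>X\<close> is the normal equation of a projection.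
  The bound combines Cauchy-Schwarz with the minimality of the projection, tested on the
  coefficients \<open>Y\<close>.\<close>

lemma schur_complement_bound:
  fixes a b P :: "nat \<Rightarrow> real" and e d :: "nat \<Rightarrow> nat \<Rightarrow> complex"
    and A B C X Y S :: "nat \<Rightarrow> nat \<Rightarrow> complex" and T :: real
  assumes a: "\<And>l. a l \<ge> 0"
    and A: "\<And>n m. n < r \<Longrightarrow> m < r \<Longrightarrow> (\<lambda>l. of_real (a l) * e n l * cnj (e m l)) sums A n m"
    and B: "\<And>n m. n < r \<Longrightarrow> m < r \<Longrightarrow> (\<lambda>l. of_real (a l) * d n l * cnj (e m l)) sums B n m"
    and C: "\<And>n m. n < r \<Longrightarrow> m < r \<Longrightarrow> (\<lambda>l. of_real (a l) * d n l * cnj (d m l)) sums C n m"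
    and X: "\<And>n m. n < r \<Longrightarrow> m < r \<Longrightarrow> (\<Sum>i<r. X n i * A i m) = B n m"
    and S: "\<And>n m. n < r \<Longrightarrow> m < r \<Longrightarrow> S n m = C n m - (\<Sum>i<r. X n i * cnj (B m i))"
    and Y: "\<And>n l. n < r \<Longrightarrow> cmod (d n l - (\<Sum>i<r. Y n i * e i l)) \<le> P n * b l"
    and P: "\<And>n. n < r \<Longrightarrow> P n > 0"
    and T: "(\<lambda>l. a l * (b l)\<^sup>2) sums T"
    and n: "n < r" and m: "m < r"
  shows "cmod (S n m) \<le> P n * P m * T"
proof -
  (* D n is the projection of d n off the span of the e i, so its squared weighted norm S n n
     is at most that of any d n - sum_i Y_i e i. *)
  define D where "D = (\<lambda>n l. d n l - (\<Sum>i<r. X n i * e i l))"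
  \<comment> \<open>The normal equations say exactly that \<open>D n\<close> is orthogonal to every
    \<open>e m\<close>.\<close>
  have De: "(\<lambda>l. of_real (a l) * D n l * cnj (e m l)) sums 0" if "n < r" "m < r" for n m
  proof -
    have "(\<lambda>l. of_real (a l) * d n l * cnj (e m l)
          - (\<Sum>i<r. X n i * (of_real (a l) * e i l * cnj (e m l)))) sums
        (B n m - (\<Sum>i<r. X n i * A i m))"
      using that by (intro sums_diff B sums_sum sums_mult A) auto
    also have "(\<lambda>l. of_real (a l) * d n l * cnj (e m l)
          - (\<Sum>i<r. X n i * (of_real (a l) * e i l * cnj (e m l)))) =
        (\<lambda>l. of_real (a l) * D n l * cnj (e m l))"
      by (simp add: D_def algebra_simps sum_distrib_left)
    finally show ?thesis using X[OF that] by simp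
  qed
  have Dd: "(\<lambda>l. of_real (a l) * D n l * cnj (d m l)) sums S n m" if "n < r" "m < r" for n m
  proof -
    have "(\<lambda>l. of_real (a l) * e i l * cnj (d m l)) sums cnj (B m i)" if "i < r" for i
      using B[OF \<open>m < r\<close> that, THEN sums_cnj[THEN iffD2]] by (simp add: mult_ac)
    hence "(\<lambda>l. of_real (a l) * d n l * cnj (d m l)
          - (\<Sum>i<r. X n i * (of_real (a l) * e i l * cnj (d m l)))) sums
        (C n m - (\<Sum>i<r. X n i * cnj (B m i)))"
      using that by (intro sums_diff C sums_sum sums_mult) auto
    also have "(\<lambda>l. of_real (a l) * d n l * cnj (d m l)
          - (\<Sum>i<r. X n i * (of_real (a l) * e i l * cnj (d m l)))) =
        (\<lambda>l. of_real (a l) * D n l * cnj (d m l))"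
      by (simp add: D_def algebra_simps sum_distrib_left)
    finally show ?thesis using S[OF that] by simp
  qed
  \<comment> \<open>By orthogonality any combination of the \<open>e i\<close> may be subtracted
    from \<open>d m\<close>. The choice \<open>X m\<close> gives the Gram matrix of
    \<open>D\<close>, the choice \<open>Y n\<close> the comparison with the trial vector.\<close>
  have DZ: "(\<lambda>l. of_real (a l) * D n l * cnj (d m l - (\<Sum>i<r. Z i * e i l))) sums S n m"
    if "n < r" "m < r" for n m Z
  proof -
    have "(\<lambda>l. of_real (a l) * D n l * cnj (d m l)
          - (\<Sum>i<r. cnj (Z i) * (of_real (a l) * D n l * cnj (e i l)))) sums
        (S n m - (\<Sum>i<r. cnj (Z i) * 0))"
      using that by (intro sums_diff Dd sums_sum sums_mult De) auto
    thus ?thesis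
      by (simp add: algebra_simps sum_distrib_left)
  qed
  have DD: "(\<lambda>l. of_real (a l) * D n l * cnj (D m l)) sums S n m" if "n < r" "m < r" for n m
    using DZ[OF that, of "X m"] by (simp add: D_def)
  have norm_D: "(\<lambda>l. a l * (cmod (D n l))\<^sup>2) sums Re (S n n)" if "n < r" for n
  proof -
    have "Re (of_real (a l) * D n l * cnj (D n l)) = a l * (cmod (D n l))\<^sup>2" for l
      by (simp add: mult.assoc complex_norm_square[symmetric] del: of_real_power)
    thus ?thesis using sums_Re[OF DD[OF that that]] by simp
  qed
  have diag: "Re (S n n) \<le> (P n)\<^sup>2 * T" if "n < r" for n
  proof -
    define E where "E = (\<lambda>l. d n l - (\<Sum>i<r. Y n i * e i l))"
    have 1: "(\<lambda>l. 2 * Re (of_real (a l) * D n l * cnj (E l))) sums (2 * Re (S n n))"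
      unfolding E_def by (intro sums_mult sums_Re DZ that)
    have 2: "(\<lambda>l. a l * (cmod (D n l))\<^sup>2 + (P n)\<^sup>2 * (a l * (b l)\<^sup>2)) sums (Re (S n n) + (P n)\<^sup>2 * T)"
      by (intro sums_add sums_mult norm_D T that)
    \<comment> \<open>The products of \<open>D n\<close> with \<open>E\<close> and with itself are
      both \<open>S n n\<close>, so \<open>2 * x * y \<le> x\<^sup>2 + y\<^sup>2\<close> leaves one
      copy of \<open>Re (S n n)\<close> to cancel.\<close>
    have "2 * Re (S n n) \<le> Re (S n n) + (P n)\<^sup>2 * T"
    proof (rule sums_le[OF _ 1 2])
      fix l
      have "2 * Re (D n l * cnj (E l)) \<le> 2 * cmod (D n l) * cmod (E l)"
        using complex_Re_le_cmod[of "D n l * cnj (E l)"] by (simp add: norm_mult)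
      also have "\<dots> \<le> (cmod (D n l))\<^sup>2 + (cmod (E l))\<^sup>2"
        by (rule sum_squares_bound)
      also have "(cmod (E l))\<^sup>2 \<le> (P n * b l)\<^sup>2"
        using Y[OF that] by (intro power_mono) (auto simp: E_def)
      finally have "a l * (2 * Re (D n l * cnj (E l))) \<le> a l * ((cmod (D n l))\<^sup>2 + (P n * b l)\<^sup>2)"
        using a by (intro mult_left_mono) auto
      thus "2 * Re (of_real (a l) * D n l * cnj (E l))
          \<le> a l * (cmod (D n l))\<^sup>2 + (P n)\<^sup>2 * (a l * (b l)\<^sup>2)"
        by (simp add: mult.assoc algebra_simps power_mult_distrib)
    qed
    thus ?thesis by simp
  qed
  (* AM-GM with this weight stands in for the Cauchy-Schwarz inequality for series. *)
  define t where "t = P m / P n"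
  have t: "t > 0" using P n m by (simp add: t_def)
  have "(\<lambda>l. (t * (a l * (cmod (D n l))\<^sup>2) + (1 / t) * (a l * (cmod (D m l))\<^sup>2)) / 2) sums
      ((t * Re (S n n) + (1 / t) * Re (S m m)) / 2)"
    by (intro sums_divide sums_add sums_mult norm_D n m)
  moreover have "cmod (of_real (a l) * D n l * cnj (D m l)) \<le>
      (t * (a l * (cmod (D n l))\<^sup>2) + (1 / t) * (a l * (cmod (D m l))\<^sup>2)) / 2" for l
  proof -
    have "2 * (sqrt t * cmod (D n l)) * (cmod (D m l) / sqrt t)
        \<le> (sqrt t * cmod (D n l))\<^sup>2 + (cmod (D m l) / sqrt t)\<^sup>2"
      by (rule sum_squares_bound)
    hence "2 * (cmod (D n l) * cmod (D m l)) \<le> t * (cmod (D n l))\<^sup>2 + (cmod (D m l))\<^sup>2 / t"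
      using t by (simp add: power_mult_distrib power_divide)
    from mult_left_mono[OF this a[of l]] show ?thesis
      using a[of l] by (simp add: norm_mult algebra_simps)
  qed
  ultimately have "cmod (S n m) \<le> (t * Re (S n n) + (1 / t) * Re (S m m)) / 2"
    using norm_sums_le[OF DD[OF n m]] by blast
  also have "\<dots> \<le> (t * ((P n)\<^sup>2 * T) + (1 / t) * ((P m)\<^sup>2 * T)) / 2"
    using t by (intro divide_right_mono add_mono mult_left_mono diag n m) auto
  \<comment> \<open>The choice of \<open>t\<close> makes both terms of the mean equal.\<close>
  also have "\<dots> = P n * P m * T"
    using P[OF n] P[OF m] by (simp add: t_def field_simps power2_eq_square)
  finally show ?thesis .
qed


section \<open>Vandermonde determinant and comparison of determinants\<close>

text \<open>Column operations replace the monomials by the monic Newton polynomials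
  \<open>f j\<close>. Their coefficient matrix \<open>U\<close> is upper triangular with unit
  diagonal, and \<open>V * U\<close> is lower triangular because \<open>f j\<close> vanishes at the
  first \<open>j\<close> points.\<close>

lemma vandermonde_det:
  fixes w :: "nat \<Rightarrow> 'a :: field"
  shows "Determinant.det (Matrix.mat r r (\<lambda>(i, l). w i ^ l)) = (\<Prod>j<r. \<Prod>i<j. w j - w i)"
proof -
  define f where "f = (\<lambda>j. \<Prod>i<j. [:- w i, 1:])"
  have deg: "degree (f j) = j" and lead: "Polynomial.coeff (f j) j = 1" for j
  proof -
    show deg: "degree (f j) = j"
      unfolding f_def by (subst degree_prod_sum_eq) auto
    have "lead_coeff (f j) = 1"
      unfolding f_def by (subst lead_coeff_prod) simp
    thus "Polynomial.coeff (f j) j = 1" by (simp add: deg)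
  qed
  define V where "V = Matrix.mat r r (\<lambda>(i, l). w i ^ l)"
  define U where "U = Matrix.mat r r (\<lambda>(l, j). Polynomial.coeff (f j) l)"
  have carrier: "V \<in> carrier_mat r r" "U \<in> carrier_mat r r"
    by (simp_all add: V_def U_def)
  have VU: "(V * U) $$ (n, j) = (\<Prod>i<j. w n - w i)" if "n < r" "j < r" for n j
  proof -
    have "(V * U) $$ (n, j) = (\<Sum>l<r. Polynomial.coeff (f j) l * w n ^ l)"
      using that by (simp add: V_def U_def scalar_prod_def atLeast0LessThan mult.commute)
    also have "\<dots> = (\<Sum>l\<le>j. Polynomial.coeff (f j) l * w n ^ l)"
      using that by (intro sum.mono_neutral_right) (auto simp: coeff_eq_0 deg)
    also have "\<dots> = poly (f j) (w n)"
      by (simp add: poly_altdef deg)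
    finally show ?thesis by (simp add: f_def poly_prod)
  qed
  have "Determinant.det (V * U) = prod_list (diag_mat (V * U))"
  proof (rule det_lower_triangular)
    show "(V * U) $$ (i, j) = 0" if "i < j" "j < r" for i j
      using that by (subst VU) auto
  qed (use carrier in auto)
  also have "\<dots> = (\<Prod>j<r. \<Prod>i<j. w j - w i)"
    using carrier VU by (simp add: prod_list_diag_prod atLeast0LessThan)
  finally have "Determinant.det V * Determinant.det U = (\<Prod>j<r. \<Prod>i<j. w j - w i)"
    using det_mult[OF carrier] by simp
  moreover have "Determinant.det U = 1"
  proof -
    have "upper_triangular U"
      by (auto simp: upper_triangular_def U_def coeff_eq_0 deg)
    hence "Determinant.det U = prod_list (diag_mat U)"
      using carrier by (intro det_upper_triangular)
    thus ?thesis by (simp add: prod_list_diag_prod U_def lead)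
  qed
  ultimately show ?thesis by (simp add: V_def)
qed

text \<open>This makes the option-valued inverse in \<open>zero_density\<close> a genuine
  inverse.\<close>

lemma mat_inverse_det_nonzero:
  fixes A :: "'a :: field mat"
  assumes "A \<in> carrier_mat n n" "Determinant.det A \<noteq> 0"
  shows "A * the (mat_inverse A) = 1\<^sub>m n" "the (mat_inverse A) * A = 1\<^sub>m n"
    "the (mat_inverse A) \<in> carrier_mat n n"
proof -
  have "mat_inverse A \<noteq> None"
    using mat_inverse(1)[OF assms(1), of "()"] det_non_zero_imp_unit[OF assms, of "()"] by blast
  thus "A * the (mat_inverse A) = 1\<^sub>m n" "the (mat_inverse A) * A = 1\<^sub>m n"
    "the (mat_inverse A) \<in> carrier_mat n n"
    using mat_inverse(2)[OF assms(1)] by auto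
qed

text \<open>After Schur triangularisation the diagonal entries are eigenvalues, and their product is
  the determinant.\<close>

lemma norm_det_ge_power:
  fixes N :: "complex mat"
  assumes N: "N \<in> carrier_mat n n" and "c \<ge> 0"
    and ev: "\<And>k. eigenvalue N k \<Longrightarrow> c \<le> cmod k"
  shows "c ^ n \<le> cmod (Determinant.det N)"
proof -
  obtain as where "char_poly N = (\<Prod>a\<leftarrow>as. [:- a, 1:])"
    using char_poly_factorized[OF N] by blast
  from schur_decomposition_exists[OF N this] obtain B where
    B: "B \<in> carrier_mat n n" "upper_triangular B" "similar_mat N B" by blast
  have "c \<le> cmod (B $$ (i, i))" if "i < n" for i
  proof (rule ev)
    have "poly (char_poly N) (B $$ (i, i)) = 0"
      unfolding char_poly_similar[OF B(3)] char_poly_upper_triangular[OF B(1,2)]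
      using that B(1) by (auto simp: poly_prod_list_zero_iff diag_mat_def)
    thus "eigenvalue N (B $$ (i, i))"
      by (simp add: eigenvalue_root_char_poly[OF N])
  qed
  hence "(\<Prod>i<n. c) \<le> (\<Prod>i<n. cmod (B $$ (i, i)))"
    using \<open>c \<ge> 0\<close> by (intro prod_mono) auto
  also have "\<dots> = cmod (Determinant.det N)"
    using det_similar[OF B(3)] det_upper_triangular[OF B(2,1)] B(1)
    by (simp add: prod_list_diag_prod atLeast0LessThan prod_norm)
  finally show ?thesis by simp
qed

text \<open>An eigenvector \<open>v\<close> of the inverse of \<open>H\<close> times
  \<open>A\<close>, with eigenvalue \<open>k\<close>, satisfies
  \<open>A *\<^sub>v v = k \<cdot>\<^sub>v (H *\<^sub>v v)\<close>. Pairing with \<open>v\<close>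
  shows that \<open>k\<close> is a quotient of the two forms, hence of modulus at least
  \<open>c\<close>.\<close>

lemma det_form_mono:
  fixes A H :: "complex mat"
  assumes A: "A \<in> carrier_mat n n" and H: "H \<in> carrier_mat n n" and "c \<ge> 0"
    and pos: "\<And>v. v \<in> carrier_vec n \<Longrightarrow> v \<noteq> 0\<^sub>v n \<Longrightarrow> 0 < cmod ((H *\<^sub>v v) \<bullet>c v)"
    and le: "\<And>v. v \<in> carrier_vec n \<Longrightarrow> c * cmod ((H *\<^sub>v v) \<bullet>c v) \<le> cmod ((A *\<^sub>v v) \<bullet>c v)"
  shows "c ^ n * cmod (Determinant.det H) \<le> cmod (Determinant.det A)"
proof -
  have "Determinant.det H \<noteq> 0"
    using pos by (fastforce simp: det_0_iff_vec_prod_zero[OF H])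
  note G = mat_inverse_det_nonzero[OF H this]
  define G where "G = the (mat_inverse H)"
  note G = G[folded G_def]
  define N where "N = G * A"
  have N: "N \<in> carrier_mat n n" using G A by (simp add: N_def)
  have A_eq: "A = H * N"
    using G A H by (simp add: N_def flip: assoc_mult_mat[of H n n])
  have "c ^ n \<le> cmod (Determinant.det N)"
  proof (rule norm_det_ge_power[OF N \<open>c \<ge> 0\<close>])
    fix k assume "eigenvalue N k"
    then obtain v where v: "v \<in> carrier_vec n" "v \<noteq> 0\<^sub>v n" "N *\<^sub>v v = k \<cdot>\<^sub>v v"
      using N by (auto simp: eigenvalue_def eigenvector_def)
    have "A *\<^sub>v v = k \<cdot>\<^sub>v (H *\<^sub>v v)"
      using v H N by (simp add: A_eq assoc_mult_mat_vec mult_mat_vec)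
    hence "c * cmod ((H *\<^sub>v v) \<bullet>c v) \<le> cmod k * cmod ((H *\<^sub>v v) \<bullet>c v)"
      using le[OF v(1)] v(1) H by (simp add: norm_mult)
    thus "c \<le> cmod k" using pos[OF v(1,2)] by simp
  qed
  hence "c ^ n * cmod (Determinant.det H) \<le> cmod (Determinant.det N) * cmod (Determinant.det H)"
    by (intro mult_right_mono) auto
  also have "\<dots> = cmod (Determinant.det A)"
    by (simp add: A_eq det_mult[OF H N] norm_mult mult.commute)
  finally show ?thesis .
qed

section \<open>Power series of the exponential kernel and its derivatives\<close>

text \<open>The weights \<open>s ^ l / fact l\<close> and the powers of the points are the
  \<open>a\<close> and \<open>e\<close> to which \<open>schur_complement_bound\<close> is applied;
  the two lemmas that follow supply \<open>d\<close>.\<close>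

lemma exp_kernel_sums:
  fixes s :: real and u v :: complex
  shows "(\<lambda>l. of_real (s ^ l / fact l) * u ^ l * v ^ l) sums exp (of_real s * u * v)"
  using exp_converges[of "of_real s * u * v"]
  by (simp add: power_mult_distrib scaleR_conv_of_real field_simps)

lemma exp_kernel_deriv_sums:
  fixes s :: real and u v :: complex
  shows "(\<lambda>l. of_real (s ^ l / fact l) * (of_nat l * u ^ (l - 1)) * v ^ l) sums
    deriv (\<lambda>u. exp (of_real s * u * v)) u"
proof -
  let ?f = "\<lambda>l. of_real (s ^ l / fact l) * (of_nat l * u ^ (l - 1)) * v ^ l"
  \<comment> \<open>The term at 0 vanishes, and after the shift \<open>Suc l\<close> cancels against
    the factorial.\<close>
  have "?f (Suc l) = (of_real s * v) * (of_real (s ^ l / fact l) * u ^ l * v ^ l)" for l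
    by (simp add: field_simps del: of_nat_Suc)
  hence "(\<lambda>l. ?f (Suc l)) sums (of_real s * v * exp (of_real s * u * v))"
    using sums_mult[OF exp_kernel_sums[of s u v], of "of_real s * v"] by simp
  hence "?f sums (of_real s * v * exp (of_real s * u * v) + ?f 0)"
    by (rule sums_Suc)
  moreover have "deriv (\<lambda>u. exp (of_real s * u * v)) u = of_real s * v * exp (of_real s * u * v)"
    by (rule DERIV_imp_deriv) (auto intro!: derivative_eq_intros)
  ultimately show ?thesis by simp
qed

lemma exp_kernel_deriv2_sums:
  fixes s :: real and u v :: complex
  shows "(\<lambda>l. of_real (s ^ l / fact l) * (of_nat l * u ^ (l - 1)) * (of_nat l * v ^ (l - 1))) sums
    deriv (\<lambda>v. deriv (\<lambda>u. exp (of_real s * u * v)) u) v"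
proof -
  let ?f = "\<lambda>l. of_real (s ^ l / fact l) * (of_nat l * u ^ (l - 1)) * (of_nat l * v ^ (l - 1))"
  let ?e = "\<lambda>v. exp (of_real s * u * v)"
  have d1: "deriv (\<lambda>u. exp (of_real s * u * v)) u = of_real s * v * ?e v" for v
    by (rule DERIV_imp_deriv) (auto intro!: derivative_eq_intros)
  have d2: "deriv (\<lambda>v. deriv (\<lambda>u. exp (of_real s * u * v)) u) v =
      of_real s * ?e v + of_real s * u * (of_real s * v * ?e v)"
    unfolding d1 by (rule DERIV_imp_deriv) (auto intro!: derivative_eq_intros simp: algebra_simps)
  have "?f (Suc l) = of_real s * (of_real (s ^ l / fact l) * u ^ l * v ^ l) +
      of_real s * u * (of_real (s ^ l / fact l) * (of_nat l * u ^ (l - 1)) * v ^ l)" for l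
  proof -
    have "?f (Suc l) = of_real s * (of_real (s ^ l / fact l) * (of_nat (Suc l) * u ^ l) * v ^ l)"
      by (simp add: field_simps del: of_nat_Suc)
    \<comment> \<open>This splitting mirrors the product rule: one part is the kernel series, the
      other the series of its first derivative.\<close>
    also have "of_nat (Suc l) * u ^ l = u ^ l + u * (of_nat l * u ^ (l - 1))"
      by (cases l) (auto simp: algebra_simps)
    finally show ?thesis by (simp add: algebra_simps)
  qed
  hence "(\<lambda>l. ?f (Suc l)) sums (of_real s * ?e v + of_real s * u * (of_real s * v * ?e v))"
    using sums_add[OF sums_mult[OF exp_kernel_sums[of s u v], of "of_real s"]
        sums_mult[OF exp_kernel_deriv_sums[of s u v], of "of_real s * u"]]
    by (simp add: d1)
  hence "?f sums (of_real s * ?e v + of_real s * u * (of_real s * v * ?e v) + ?f 0)"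
    by (rule sums_Suc)
  thus ?thesis by (simp add: d2)
qed

section \<open>Bounds for the permanent and the kernel determinant\<close>

text \<open>In each term of the permanent every \<open>P i\<close> occurs twice, once through its
  row and once through its column.\<close>

lemma norm_permanent_le:
  fixes X :: "complex mat" and P :: "nat \<Rightarrow> real"
  assumes "X \<in> carrier_mat r r"
    and le: "\<And>i j. i < r \<Longrightarrow> j < r \<Longrightarrow> cmod (X $$ (i, j)) \<le> P i * P j * T"
  shows "cmod (permanent X) \<le> fact r * (T ^ r * (\<Prod>i<r. P i)\<^sup>2)"
proof -
  have "cmod (permanent X) \<le> (\<Sum>\<pi> | \<pi> permutes {..<r}. cmod (\<Prod>i<r. X $$ (i, \<pi> i)))"
    using assms(1) by (auto simp: permanent_def intro: norm_sum)
  also have "\<dots> \<le> (\<Sum>\<pi> | \<pi> permutes {..<r}. T ^ r * (\<Prod>i<r. P i)\<^sup>2)"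
  proof (intro sum_mono)
    fix \<pi> assume "\<pi> \<in> {\<pi>. \<pi> permutes {..<r}}"
    hence \<pi>: "\<pi> permutes {..<r}" by simp
    hence "\<pi> i < r" if "i < r" for i
      using that permutes_in_image[OF \<pi>, of i] by simp
    hence "cmod (\<Prod>i<r. X $$ (i, \<pi> i)) \<le> (\<Prod>i<r. P i * P (\<pi> i) * T)"
      unfolding prod_norm[symmetric] by (intro prod_mono) (auto intro: le)
    also have "\<dots> = T ^ r * ((\<Prod>i<r. P i) * (\<Prod>i<r. P (\<pi> i)))"
      by (simp add: prod.distrib)
    also have "(\<Prod>i<r. P (\<pi> i)) = (\<Prod>i<r. P i)"
      using prod.permute[OF \<pi>, of P] by (simp add: o_def)
    finally show "cmod (\<Prod>i<r. X $$ (i, \<pi> i)) \<le> T ^ r * (\<Prod>i<r. P i)\<^sup>2"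
      by (simp add: power2_eq_square)
  qed
  also have "\<dots> = fact r * (T ^ r * (\<Prod>i<r. P i)\<^sup>2)"
    using card_permutations[of "{..<r}" r] by simp
  finally show ?thesis .
qed


text \<open>Every unordered pair is counted twice on the left. This identifies the product of the
  interpolation factors with the squared modulus of the Vandermonde determinant.\<close>

lemma prod_offdiag_symmetric:
  fixes f :: "nat \<Rightarrow> nat \<Rightarrow> 'a :: comm_semiring_1"
  assumes "\<And>i j. f i j = f j i"
  shows "(\<Prod>i<r. \<Prod>j\<in>{..<r} - {i}. f i j) = (\<Prod>j<r. \<Prod>i<j. f j i)\<^sup>2"
proof (induction r)
  case (Suc r)
  have "{..<Suc r} - {i} = insert r ({..<r} - {i})" if "i < r" for i
    using that by auto
  hence "(\<Prod>i<r. \<Prod>j\<in>{..<Suc r} - {i}. f i j) = (\<Prod>i<r. f i r * (\<Prod>j\<in>{..<r} - {i}. f i j))"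
    by (intro prod.cong) auto
  also have "\<dots> = (\<Prod>i<r. f r i) * (\<Prod>j<r. \<Prod>i<j. f j i)\<^sup>2"
    by (simp add: prod.distrib Suc assms[of _ r])
  moreover have "{..<Suc r} - {r} = {..<r}" by auto
  ultimately show ?case
    by (simp add: power2_eq_square mult_ac)
qed auto

lemma hermitian_form_index:
  fixes X :: "complex mat"
  assumes "X \<in> carrier_mat n n" "v \<in> carrier_vec n"
  shows "(X *\<^sub>v v) \<bullet>c v = (\<Sum>i<n. \<Sum>j<n. X $$ (i, j) * v $ j * cnj (v $ i))"
  using assms by (simp add: scalar_prod_def atLeast0LessThan sum_distrib_right)

text \<open>Keeping the first \<open>r\<close> terms of the kernel series, with weights lowered to
  \<open>c\<close>, leaves \<open>c\<close> times the Vandermonde matrix times its adjoint. As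
  quadratic forms the discarded part is nonnegative, so \<open>det_form_mono\<close>
  applies.\<close>

lemma exp_kernel_det_lower_bound:
  fixes s c :: real and w :: "nat \<Rightarrow> complex"
  assumes "s > 0" "c \<ge> 0" and c: "\<And>l. l < r \<Longrightarrow> c \<le> s ^ l / fact l"
    and inj: "inj_on w {..<r}"
  shows "c ^ r * (\<Prod>j<r. \<Prod>i<j. cmod (w j - w i))\<^sup>2
    \<le> cmod (Determinant.det (kernel_A (\<lambda>u v. exp (of_real s * u * v)) r w))"
proof -
  define A where "A = kernel_A (\<lambda>u v. exp (of_real s * u * v)) r w"
  have A: "A \<in> carrier_mat r r" by (simp add: A_def kernel_A_def)
  define V where "V = Matrix.mat r r (\<lambda>(i, l). w i ^ l)"
  define V' where "V' = transpose_mat (map_mat cnj V)"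
  have V: "V \<in> carrier_mat r r" and V': "V' \<in> carrier_mat r r"
    by (simp_all add: V_def V'_def)
  have det_V: "cmod (Determinant.det V) = (\<Prod>j<r. \<Prod>i<j. cmod (w j - w i))"
    unfolding V_def vandermonde_det by (simp add: prod_norm)
  interpret cnj: comm_ring_hom cnj by standard auto
  have det_V': "Determinant.det V' = cnj (Determinant.det V)"
    unfolding V'_def using V by (subst det_transpose[of _ r]) auto
  have "Determinant.det V \<noteq> 0"
    unfolding V_def vandermonde_det using inj by (auto dest!: inj_onD)
  define H where "H = V * V'"
  have H: "H \<in> carrier_mat r r" using V V' by (simp add: H_def)
  \<comment> \<open>For \<open>l < r\<close> these are the coordinates of
    \<open>V' *\<^sub>v v\<close>. The form of \<open>H\<close> sums their squared moduli over
    \<open>l < r\<close>, the form of the kernel matrix over all \<open>l\<close> with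
    weights.\<close>
  define g where "g = (\<lambda>(v :: complex Matrix.vec) l. \<Sum>j<r. cnj (w j) ^ l * v $ j)"
  have V'v: "(V' *\<^sub>v v) $ l = g v l" if "v \<in> carrier_vec r" "l < r" for v l
    using that by (simp add: V'_def V_def g_def scalar_prod_def atLeast0LessThan)
  have g_norm: "(\<Sum>i<r. \<Sum>j<r. of_real a * w i ^ l * cnj (w j) ^ l * v $ j * cnj (v $ i))
      = of_real (a * (cmod (g v l))\<^sup>2)" for a l and v :: "complex Matrix.vec"
  proof -
    have "complex_of_real (a * (cmod (g v l))\<^sup>2) = of_real a * (cnj (g v l) * g v l)"
      by (simp add: complex_norm_square mult.commute del: of_real_power)
    also have "cnj (g v l) * g v l = (\<Sum>i<r. \<Sum>j<r. (w i ^ l * cnj (v $ i)) * (cnj (w j) ^ l * v $ j))"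
      by (simp add: g_def sum_product)
    finally show ?thesis by (simp add: sum_distrib_left mult_ac)
  qed
  have form_H: "(H *\<^sub>v v) \<bullet>c v = of_real (\<Sum>l<r. (cmod (g v l))\<^sup>2)" if "v \<in> carrier_vec r" for v
  proof -
    have "H $$ (i, j) = (\<Sum>l<r. w i ^ l * cnj (w j) ^ l)" if "i < r" "j < r" for i j
      using that by (simp add: H_def V_def V'_def scalar_prod_def atLeast0LessThan)
    hence "(H *\<^sub>v v) \<bullet>c v = (\<Sum>i<r. \<Sum>j<r. (\<Sum>l<r. w i ^ l * cnj (w j) ^ l) * v $ j * cnj (v $ i))"
      unfolding hermitian_form_index[OF H that] by (intro sum.cong) auto
    also have "\<dots> = (\<Sum>i<r. \<Sum>l<r. \<Sum>j<r. w i ^ l * cnj (w j) ^ l * v $ j * cnj (v $ i))"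
      unfolding sum_distrib_right by (intro sum.cong refl sum.swap)
    also have "\<dots> = (\<Sum>l<r. \<Sum>i<r. \<Sum>j<r. w i ^ l * cnj (w j) ^ l * v $ j * cnj (v $ i))"
      by (rule sum.swap)
    finally show ?thesis using g_norm[of 1 _ v] by simp
  qed
  have form_A: "(\<lambda>l. s ^ l / fact l * (cmod (g v l))\<^sup>2) sums Re ((A *\<^sub>v v) \<bullet>c v)"
    if "v \<in> carrier_vec r" for v
  proof -
    have "(\<lambda>l. \<Sum>i<r. \<Sum>j<r. of_real (s ^ l / fact l) * w i ^ l * cnj (w j) ^ l * v $ j * cnj (v $ i))
        sums (\<Sum>i<r. \<Sum>j<r. exp (of_real s * w i * cnj (w j)) * v $ j * cnj (v $ i))"
      by (intro sums_sum sums_mult2 exp_kernel_sums)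
    hence "(\<lambda>l. of_real (s ^ l / fact l * (cmod (g v l))\<^sup>2)) sums ((A *\<^sub>v v) \<bullet>c v)"
      unfolding g_norm hermitian_form_index[OF A that]
      by (simp add: A_def kernel_A_def del: of_real_mult of_real_divide of_real_power)
    from sums_Re[OF this] show ?thesis by (simp only: Re_complex_of_real)
  qed
  have "c ^ r * cmod (Determinant.det H) \<le> cmod (Determinant.det A)"
  proof (rule det_form_mono[OF A H \<open>c \<ge> 0\<close>])
    fix v :: "complex Matrix.vec" assume v: "v \<in> carrier_vec r"
    show "0 < cmod ((H *\<^sub>v v) \<bullet>c v)" if "v \<noteq> 0\<^sub>v r"
    \<comment> \<open>A vanishing form would put \<open>v\<close> into the kernel of the invertible
      matrix \<open>V'\<close>.\<close>
    proof (rule ccontr)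
      assume "\<not> 0 < cmod ((H *\<^sub>v v) \<bullet>c v)"
      hence "(\<Sum>l<r. (cmod (g v l))\<^sup>2) = 0"
        by (simp only: form_H[OF v] norm_of_real zero_less_abs_iff not_not)
      hence "\<forall>l<r. g v l = 0" by (simp add: sum_nonneg_eq_0_iff)
      hence "V' *\<^sub>v v = 0\<^sub>v r" using V'v[OF v] V' by (intro eq_vecI) auto
      hence "Determinant.det V' = 0"
        using det_0_iff_vec_prod_zero[OF V'] v that by blast
      thus False using det_V' \<open>Determinant.det V \<noteq> 0\<close> by simp
    qed
    have "c * cmod ((H *\<^sub>v v) \<bullet>c v) = (\<Sum>l<r. c * (cmod (g v l))\<^sup>2)"
      unfolding form_H[OF v] norm_of_real
      by (subst abs_of_nonneg) (auto intro: sum_nonneg simp: sum_distrib_left)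
    also have "\<dots> \<le> (\<Sum>l<r. s ^ l / fact l * (cmod (g v l))\<^sup>2)"
      using c by (intro sum_mono mult_right_mono) auto
    \<comment> \<open>The tail of the series is nonnegative.\<close>
    also have "\<dots> \<le> (\<Sum>l. s ^ l / fact l * (cmod (g v l))\<^sup>2)"
      using form_A[OF v] \<open>s > 0\<close> by (intro sum_le_suminf) (auto dest: sums_summable)
    also have "\<dots> \<le> cmod ((A *\<^sub>v v) \<bullet>c v)"
      using form_A[OF v] complex_Re_le_cmod by (simp add: sums_iff)
    finally show "c * cmod ((H *\<^sub>v v) \<bullet>c v) \<le> cmod ((A *\<^sub>v v) \<bullet>c v)" .
  qed
  moreover have "cmod (Determinant.det H) = (cmod (Determinant.det V))\<^sup>2"
    by (simp add: H_def det_mult[OF V V'] det_V' norm_mult power2_eq_square)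
  ultimately show ?thesis by (simp add: det_V A_def)
qed

section \<open>Zero density of a single Gaussian analytic function\<close>

lemma index_mat_adjoint:
  "i < dim_col B \<Longrightarrow> j < dim_row B \<Longrightarrow> mat_adjoint B $$ (i, j) = conjugate (B $$ (j, i))"
  "dim_row (mat_adjoint B) = dim_col B" "dim_col (mat_adjoint B) = dim_row B"
  by (simp_all add: mat_adjoint_def mat_of_rows_def)

text \<open>With \<open>Q\<close> the squared Vandermonde modulus, the permanent is at most a
  multiple of \<open>Q\<^sup>2\<close> and the determinant at least a multiple of \<open>Q\<close>,
  so one factor \<open>Q\<close> survives the division.\<close>

lemma zero_density_exp_kernel_bound:
  fixes s R :: real
  assumes "s > 0" "R \<ge> 1"
  shows "\<exists>C\<ge>0. \<forall>w. inj_on w {..<r} \<and> (\<forall>i<r. cmod (w i) \<le> R) \<longrightarrow>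
    \<bar>zero_density (\<lambda>u v. exp (of_real s * u * v)) r w\<bar> \<le> C * (\<Prod>j<r. \<Prod>i<j. cmod (w j - w i))\<^sup>2"
proof -
  \<comment> \<open>Inserting 1 keeps the set nonempty when \<open>r = 0\<close>.\<close>
  define c where "c = Min (insert 1 ((\<lambda>l. s ^ l / fact l) ` {..<r}))"
  have c: "c > 0" "\<And>l. l < r \<Longrightarrow> c \<le> s ^ l / fact l"
    using \<open>s > 0\<close> by (auto simp: c_def)
  \<comment> \<open>\<open>T\<close> is the squared weighted norm of the bound in
    \<open>derivative_interpolation_bound\<close> without the factor \<open>P n\<close>; it is
    finite because the weights contain \<open>1 / fact l\<close>.\<close>
  define T where "T = 4 ^ r * exp (s * (4 * R\<^sup>2))"
  have T: "(\<lambda>l. s ^ l / fact l * (2 ^ r * (2 * R) ^ l)\<^sup>2) sums T"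
  proof -
    have "(x ^ m)\<^sup>2 = (x\<^sup>2) ^ m" for x :: real and m
      by (simp add: mult.commute flip: power_mult)
    hence "(2 ^ r * (2 * R) ^ l)\<^sup>2 = 4 ^ r * (4 * R\<^sup>2) ^ l" for l
      unfolding power_mult_distrib[of "2 ^ r" "(2 * R) ^ l" 2] by (simp only: power_mult_distrib) simp
    moreover have "(\<lambda>l. 4 ^ r * (s ^ l / fact l * (4 * R\<^sup>2) ^ l)) sums T"
      unfolding T_def using exp_converges[of "s * (4 * R\<^sup>2)"]
      by (intro sums_mult) (simp add: power_mult_distrib scaleR_conv_of_real field_simps)
    ultimately show ?thesis by (simp add: mult_ac)
  qed
  have "T > 0" by (simp add: T_def)
  define C where "C = fact r * T ^ r / (pi * c) ^ r"
  show ?thesis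
  proof (intro exI[of _ C] conjI allI impI; (elim conjE)?)
    show "C \<ge> 0" using c \<open>T > 0\<close> by (simp add: C_def)
    fix w :: "nat \<Rightarrow> complex"
    assume inj: "inj_on w {..<r}" and R: "\<forall>i<r. cmod (w i) \<le> R"
    let ?K = "\<lambda>u v. exp (of_real s * u * v)"
    define P where "P = (\<lambda>n. \<Prod>i\<in>{..<r} - {n}. cmod (w n - w i))"
    define Q where "Q = (\<Prod>j<r. \<Prod>i<j. cmod (w j - w i))\<^sup>2"
    have PQ: "(\<Prod>n<r. P n) = Q"
      unfolding P_def Q_def by (rule prod_offdiag_symmetric) (rule norm_minus_commute)
    have P: "P n > 0" if "n < r" for n
      unfolding P_def using inj that by (intro prod_pos) (auto dest!: inj_onD)
    hence "Q > 0" unfolding PQ[symmetric] by (intro prod_pos) auto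
    \<comment> \<open>\<open>D\<close> holds the mixed second derivatives, as \<open>C\<close>
      already names the constant.\<close>
    define A B D where "A = kernel_A ?K r w" and "B = kernel_B ?K r w" and "D = kernel_C ?K r w"
    have carrier: "A \<in> carrier_mat r r" "B \<in> carrier_mat r r" "D \<in> carrier_mat r r"
      by (simp_all add: A_def B_def D_def kernel_A_def kernel_B_def kernel_C_def)
    have det_A: "c ^ r * Q \<le> cmod (Determinant.det A)"
      unfolding A_def Q_def using \<open>s > 0\<close> c inj
      by (intro exp_kernel_det_lower_bound) auto
    moreover have "0 < c ^ r * Q" using c \<open>Q > 0\<close> by simp
    ultimately have "Determinant.det A \<noteq> 0" by auto
    note G = mat_inverse_det_nonzero[OF carrier(1) this]
    define G where "G = the (mat_inverse A)"
    note G = G[folded G_def]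
    \<comment> \<open>With this \<open>X\<close>, the matrix inside the permanent is
      \<open>D - X * mat_adjoint B\<close>, and \<open>X * A = B\<close> gives the normal
      equations.\<close>
    define X where "X = B * G"
    have X_carrier: "X \<in> carrier_mat r r" using carrier G by (simp add: X_def)
    have "X * A = B"
      using G carrier by (simp add: X_def assoc_mult_mat[of B r r G r A r])
    moreover have "(X * A) $$ (n, m) = (\<Sum>i<r. X $$ (n, i) * A $$ (i, m))" if "n < r" "m < r" for n m
      using that carrier X_carrier by (simp add: scalar_prod_def atLeast0LessThan)
    ultimately have XA: "(\<Sum>i<r. X $$ (n, i) * A $$ (i, m)) = B $$ (n, m)"
      if "n < r" "m < r" for n m
      using that by metis
    have "\<forall>n\<in>{..<r}. \<exists>y. \<forall>l. cmod (of_nat l * w n ^ (l - 1) - (\<Sum>i<r. y i * w i ^ l))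
        \<le> P n * (2 ^ r * (2 * R) ^ l)"
      unfolding P_def using inj R \<open>R \<ge> 1\<close> by (intro ballI derivative_interpolation_bound) auto
    then obtain Y where "\<forall>n\<in>{..<r}. \<forall>l. cmod (of_nat l * w n ^ (l - 1) - (\<Sum>i<r. Y n i * w i ^ l))
        \<le> P n * (2 ^ r * (2 * R) ^ l)"
      unfolding bchoice_iff by blast
    hence Y: "\<And>n l. n < r \<Longrightarrow> cmod (of_nat l * w n ^ (l - 1) - (\<Sum>i<r. Y n i * w i ^ l))
        \<le> P n * (2 ^ r * (2 * R) ^ l)"
      by simp
    let ?S = "D - X * mat_adjoint B"
    have S: "?S \<in> carrier_mat r r"
      using carrier X_carrier by (intro carrier_matI) (simp_all add: index_mat_adjoint)
    have "cmod (permanent ?S) \<le> fact r * (T ^ r * (\<Prod>i<r. P i)\<^sup>2)"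
    proof (rule norm_permanent_le[OF S])
      fix n m assume nm: "n < r" "m < r"
      show "cmod (?S $$ (n, m)) \<le> P n * P m * T"
      proof (rule schur_complement_bound[where r = r and a = "\<lambda>l. s ^ l / fact l"
            and e = "\<lambda>n l. w n ^ l" and d = "\<lambda>n l. of_nat l * w n ^ (l - 1)"
            and b = "\<lambda>l. 2 ^ r * (2 * R) ^ l" and Y = Y
            and A = "\<lambda>n m. A $$ (n, m)" and B = "\<lambda>n m. B $$ (n, m)"
            and C = "\<lambda>n m. D $$ (n, m)" and X = "\<lambda>n m. X $$ (n, m)"
            and S = "\<lambda>n m. ?S $$ (n, m)"])
        show "?S $$ (n, m) = D $$ (n, m) - (\<Sum>i<r. X $$ (n, i) * cnj (B $$ (m, i)))"
          if "n < r" "m < r" for n m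
          using that carrier X_carrier
          by (simp add: index_mat_adjoint scalar_prod_def atLeast0LessThan)
        show "(\<lambda>l. of_real (s ^ l / fact l) * w n ^ l * cnj (w m ^ l)) sums A $$ (n, m)"
          if "n < r" "m < r" for n m
          using exp_kernel_sums[of s "w n" "cnj (w m)"] that by (simp add: A_def kernel_A_def)
        show "(\<lambda>l. of_real (s ^ l / fact l) * (of_nat l * w n ^ (l - 1)) * cnj (w m ^ l)) sums B $$ (n, m)"
          if "n < r" "m < r" for n m
          using exp_kernel_deriv_sums[of s "w n" "cnj (w m)"] that by (simp add: B_def kernel_B_def)
        show "(\<lambda>l. of_real (s ^ l / fact l) * (of_nat l * w n ^ (l - 1)) * cnj (of_nat l * w m ^ (l - 1)))
            sums D $$ (n, m)" if "n < r" "m < r" for n m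
          using exp_kernel_deriv2_sums[of s "w n" "cnj (w m)"] that by (simp add: D_def kernel_C_def)
        show "s ^ l / fact l \<ge> 0" for l
          using \<open>s > 0\<close> by simp
      qed (fact XA Y P T nm)+
    qed
    hence perm: "cmod (permanent ?S) \<le> fact r * T ^ r * Q\<^sup>2"
      by (simp add: PQ mult_ac)
    have "zero_density ?K r w = Re (permanent ?S / Determinant.det (of_real pi \<cdot>\<^sub>m A))"
      by (simp only: zero_density_def X_def A_def B_def D_def G_def)
    hence "\<bar>zero_density ?K r w\<bar> \<le> cmod (permanent ?S / Determinant.det (of_real pi \<cdot>\<^sub>m A))"
      by (simp only: abs_Re_le_cmod)
    also have "\<dots> = cmod (permanent ?S) / (pi ^ r * cmod (Determinant.det A))"
      using carrier by (simp add: norm_divide norm_mult norm_power)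
    also have "\<dots> \<le> (fact r * T ^ r * Q\<^sup>2) / (pi ^ r * (c ^ r * Q))"
      using perm det_A c \<open>Q > 0\<close> \<open>T > 0\<close>
      by (intro frac_le mult_left_mono) auto
    also have "\<dots> = C * Q"
      using c \<open>Q > 0\<close> by (simp add: C_def power2_eq_square power_mult_distrib field_simps)
    finally show "\<bar>zero_density ?K r w\<bar> \<le> C * (\<Prod>j<r. \<Prod>i<j. cmod (w j - w i))\<^sup>2"
      by (simp add: Q_def)
  qed
qed

text \<open>Each distance is at most \<open>2 * R\<close>; the second estimate spares the pair of
  the first two points.\<close>

lemma prod_pairwise_dist_le:
  fixes w :: "nat \<Rightarrow> complex" and R :: real
  assumes w: "\<And>i. i < r \<Longrightarrow> cmod (w i) \<le> R" and "R \<ge> 1"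
  shows "(\<Prod>j<r. \<Prod>i<j. cmod (w j - w i)) \<le> (\<Prod>j<r. (2 * R) ^ j)"
    and "2 \<le> r \<Longrightarrow>
      (\<Prod>j<r. \<Prod>i<j. cmod (w j - w i)) \<le> (\<Prod>j<r. (2 * R) ^ j) * cmod (w 1 - w 0)"
proof -
  have le: "cmod (w j - w i) \<le> 2 * R" if "j < r" "i < j" for i j
    using norm_triangle_ineq4[of "w j" "w i"] w[of i] w[of j] that by linarith
  have "(\<Prod>j<r. \<Prod>i<j. cmod (w j - w i)) \<le> (\<Prod>j<r. \<Prod>i<j. 2 * R)"
    using le by (intro prod_mono conjI prod_nonneg) auto
  thus "(\<Prod>j<r. \<Prod>i<j. cmod (w j - w i)) \<le> (\<Prod>j<r. (2 * R) ^ j)"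
    by simp
  assume "2 \<le> r"
  define \<delta> where "\<delta> = cmod (w 1 - w 0)"
  \<comment> \<open>\<open>h\<close> marks the pair that is kept. As \<open>2 * R \<ge> 1\<close>,
    that pair can carry the factor \<open>2 * R\<close> as well, and the power count stays the same
    as in the first estimate.\<close>
  define h where "h = (\<lambda>(j :: nat) (i :: nat). if j = 1 \<and> i = 0 then \<delta> else 1)"
  have "(\<Prod>j<r. \<Prod>i<j. cmod (w j - w i)) \<le> (\<Prod>j<r. \<Prod>i<j. 2 * R * h j i)"
  proof (intro prod_mono conjI prod_nonneg)
    fix j i assume "j \<in> {..<r}" "i \<in> {..<j}"
    have "1 * \<delta> \<le> 2 * R * \<delta>"
      using \<open>R \<ge> 1\<close> by (intro mult_right_mono) (auto simp: \<delta>_def)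
    thus "cmod (w j - w i) \<le> 2 * R * h j i"
      using le[of j i] \<open>j \<in> {..<r}\<close> \<open>i \<in> {..<j}\<close> by (auto simp: h_def \<delta>_def)
  qed auto
  also have "\<dots> = (\<Prod>j<r. (2 * R) ^ j) * (\<Prod>j<r. \<Prod>i<j. h j i)"
    by (simp add: prod.distrib)
  also have "(\<Prod>j<r. \<Prod>i<j. h j i) = (\<Prod>j<r. if j = 1 then \<delta> else 1)"
    by (intro prod.cong) (auto simp: h_def)
  also have "\<dots> = \<delta>" using \<open>2 \<le> r\<close> by simp
  finally show "(\<Prod>j<r. \<Prod>i<j. cmod (w j - w i)) \<le> (\<Prod>j<r. (2 * R) ^ j) * cmod (w 1 - w 0)"
    by (simp add: \<delta>_def)
qed

text \<open>The Vandermonde bound is weakened to the two forms that the product needs: plain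
  boundedness for most factors, and quadratic repulsion of two points for one of them.\<close>

lemma zero_density_exp_kernel_repulsion:
  fixes s R :: real
  assumes "s > 0" "R \<ge> 1"
  shows "\<exists>C\<ge>0. \<forall>w. inj_on w {..<r} \<and> (\<forall>i<r. cmod (w i) \<le> R) \<longrightarrow>
    \<bar>zero_density (\<lambda>u v. exp (of_real s * u * v)) r w\<bar> \<le> C \<and>
    (2 \<le> r \<longrightarrow> \<bar>zero_density (\<lambda>u v. exp (of_real s * u * v)) r w\<bar> \<le> C * (cmod (w 1 - w 0))\<^sup>2)"
proof -
  from zero_density_exp_kernel_bound[OF assms, of r] obtain C where "C \<ge> 0" and
    C: "\<And>w. inj_on w {..<r} \<Longrightarrow> \<forall>i<r. cmod (w i) \<le> R \<Longrightarrow>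
      \<bar>zero_density (\<lambda>u v. exp (of_real s * u * v)) r w\<bar> \<le> C * (\<Prod>j<r. \<Prod>i<j. cmod (w j - w i))\<^sup>2"
    by blast
  define M where "M = (\<Prod>j<r. (2 * R) ^ j)"
  show ?thesis
  proof (intro exI[of _ "C * M\<^sup>2"] conjI allI impI; (elim conjE)?)
    show "C * M\<^sup>2 \<ge> 0" using \<open>C \<ge> 0\<close> by simp
    fix w :: "nat \<Rightarrow> complex"
    assume inj: "inj_on w {..<r}" and R: "\<forall>i<r. cmod (w i) \<le> R"
    let ?p = "\<Prod>j<r. \<Prod>i<j. cmod (w j - w i)"
    have "?p \<ge> 0" by (intro prod_nonneg) auto
    have "C * ?p\<^sup>2 \<le> C * M\<^sup>2"
      unfolding M_def using R \<open>R \<ge> 1\<close> \<open>C \<ge> 0\<close> \<open>?p \<ge> 0\<close>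
      by (intro mult_left_mono power_mono prod_pairwise_dist_le) auto
    thus "\<bar>zero_density (\<lambda>u v. exp (of_real s * u * v)) r w\<bar> \<le> C * M\<^sup>2"
      using C[OF inj R] by linarith
    assume "2 \<le> r"
    hence "C * ?p\<^sup>2 \<le> C * (M * cmod (w 1 - w 0))\<^sup>2"
      unfolding M_def using R \<open>R \<ge> 1\<close> \<open>C \<ge> 0\<close> \<open>?p \<ge> 0\<close>
      by (intro mult_left_mono power_mono prod_pairwise_dist_le) auto
    thus "\<bar>zero_density (\<lambda>u v. exp (of_real s * u * v)) r w\<bar> \<le> C * M\<^sup>2 * (cmod (w 1 - w 0))\<^sup>2"
      using C[OF inj R] by (simp add: power_mult_distrib)
  qed
qed

section \<open>Products of independent functions and the pigeonhole argument\<close>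

text \<open>Symmetry of \<open>f\<close> matters because the pair will be the image of two indices
  under a permutation, in unknown order.\<close>

lemma sum_pairs_ge:
  fixes f :: "nat \<Rightarrow> nat \<Rightarrow> real"
  assumes f: "\<And>i j. f i j \<ge> 0" "\<And>i j. f i j = f j i" and "p < k" "q < k" "p \<noteq> q"
  shows "f p q \<le> (\<Sum>j<k. \<Sum>i<j. f i j)"
proof -
  have "f p q \<le> (\<Sum>j<k. \<Sum>i<j. f i j)" if "p < q" "q < k" for p q
  proof -
    have "f p q \<le> (\<Sum>i<q. f i q)"
      using that f(1) by (intro member_le_sum) auto
    also have "\<dots> \<le> (\<Sum>j<k. \<Sum>i<j. f i j)"
      using that f(1) by (intro member_le_sum[of q "{..<k}" "\<lambda>j. \<Sum>i<j. f i j"]) (auto intro: sum_nonneg)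
    finally show ?thesis .
  qed
  from this[of p q] this[of q p] show ?thesis
    using assms(3-5) f(2)[of p q] by (cases "p < q") auto
qed

text \<open>Since \<open>k > J\<close> points are shared among \<open>J\<close> factors, some factor
  receives at least two of them. It supplies a squared distance, and all other factors are merely
  bounded.\<close>

lemma prod_zero_density_repulsion:
  fixes F :: "nat \<Rightarrow> nat \<Rightarrow> real"
  assumes "J < k" and \<alpha>: "(\<Sum>j<J. \<alpha> j) = k" and \<tau>: "\<tau> permutes {..<k}"
    and inj: "inj_on w {..<k}" and R: "\<And>i. i < k \<Longrightarrow> cmod (w i) \<le> R"
    and F0: "\<And>j r. j < J \<Longrightarrow> F j r \<ge> 0"
    and F: "\<And>j r w. j < J \<Longrightarrow> inj_on w {..<r} \<Longrightarrow> \<forall>i<r. cmod (w i) \<le> R \<Longrightarrow>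
      \<bar>zero_density (K j) r w\<bar> \<le> F j r \<and>
      (2 \<le> r \<longrightarrow> \<bar>zero_density (K j) r w\<bar> \<le> F j r * (cmod (w 1 - w 0))\<^sup>2)"
  shows "(\<Prod>j<J. zero_density (K j) (\<alpha> j) (\<lambda>i. w (\<tau> ((\<Sum>l<j. \<alpha> l) + i))))
    \<le> (\<Prod>j<J. F j (\<alpha> j)) * (\<Sum>j<k. \<Sum>i<j. (cmod (w i - w j))\<^sup>2)"
proof -
  define v where "v = (\<lambda>j i. w (\<tau> ((\<Sum>l<j. \<alpha> l) + i)))"
  define z where "z = (\<lambda>j. \<bar>zero_density (K j) (\<alpha> j) (v j)\<bar>)"
  have block: "(\<Sum>l<j. \<alpha> l) + i < k" if "j < J" "i < \<alpha> j" for i j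
  proof -
    have "(\<Sum>l<j. \<alpha> l) + i < (\<Sum>l<Suc j. \<alpha> l)" using that by simp
    also have "\<dots> \<le> k"
      unfolding \<alpha>[symmetric] using that by (intro sum_mono2) auto
    finally show ?thesis .
  qed
  have \<tau>k: "\<tau> i < k \<longleftrightarrow> i < k" for i
    using permutes_in_image[OF \<tau>, of i] by simp
  have v_inj: "inj_on (v j) {..<\<alpha> j}" if "j < J" for j
  proof (rule inj_onI)
    fix a b assume ab: "a \<in> {..<\<alpha> j}" "b \<in> {..<\<alpha> j}" "v j a = v j b"
    have "\<tau> ((\<Sum>l<j. \<alpha> l) + a) = \<tau> ((\<Sum>l<j. \<alpha> l) + b)"
      using ab block[OF that, of a] block[OF that, of b]
      by (intro inj_onD[OF inj]) (simp_all add: v_def \<tau>k)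
    thus "a = b" using injD[OF permutes_inj[OF \<tau>]] by fastforce
  qed
  have v_R: "\<forall>i<\<alpha> j. cmod (v j i) \<le> R" if "j < J" for j
    unfolding v_def by (intro allI impI R) (simp add: \<tau>k block that)
  note Fv = F[OF _ v_inj v_R]
  \<comment> \<open>Pigeonhole: otherwise the \<open>\<alpha> j\<close> would sum to at most
    \<open>J\<close>.\<close>
  have "\<exists>m<J. 2 \<le> \<alpha> m"
  proof (rule ccontr)
    assume "\<not> (\<exists>m<J. 2 \<le> \<alpha> m)"
    hence "(\<Sum>j<J. \<alpha> j) \<le> (\<Sum>j<J. 1)" by (intro sum_mono) auto
    thus False using \<alpha> \<open>J < k\<close> by simp
  qed
  then obtain m where m: "m < J" "2 \<le> \<alpha> m" by blast
  \<comment> \<open>These are the original indices of the first two points of block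
    \<open>m\<close>; \<open>+ 0\<close> keeps the shape used in \<open>v\<close> and
    \<open>block\<close>.\<close>
  define p q where "p = \<tau> ((\<Sum>l<m. \<alpha> l) + 1)" and "q = \<tau> ((\<Sum>l<m. \<alpha> l) + 0)"
  have "p \<noteq> q"
    unfolding p_def q_def using permutes_inj[OF \<tau>] by (simp add: inj_eq)
  moreover have "p < k" "q < k"
    unfolding p_def q_def \<tau>k using m by (intro block; simp)+
  ultimately have pq: "(cmod (w p - w q))\<^sup>2 \<le> (\<Sum>j<k. \<Sum>i<j. (cmod (w i - w j))\<^sup>2)"
    by (intro sum_pairs_ge[of "\<lambda>i j. (cmod (w i - w j))\<^sup>2"]) (auto simp: norm_minus_commute)
  have "z m \<le> F m (\<alpha> m) * (cmod (w p - w q))\<^sup>2"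
    using Fv[of m] m by (auto simp: z_def v_def p_def q_def)
  also have "\<dots> \<le> F m (\<alpha> m) * (\<Sum>j<k. \<Sum>i<j. (cmod (w i - w j))\<^sup>2)"
    using pq F0 m by (intro mult_left_mono) auto
  finally have zm: "z m \<le> F m (\<alpha> m) * (\<Sum>j<k. \<Sum>i<j. (cmod (w i - w j))\<^sup>2)" .
  \<comment> \<open>Absolute values avoid any claim about the sign of the densities.\<close>
  have "(\<Prod>j<J. zero_density (K j) (\<alpha> j) (v j)) \<le> \<bar>\<Prod>j<J. zero_density (K j) (\<alpha> j) (v j)\<bar>"
    by simp
  also have "\<dots> = (\<Prod>j<J. z j)" by (simp add: z_def abs_prod)
  also have "\<dots> = z m * (\<Prod>j\<in>{..<J} - {m}. z j)"
    using m by (intro prod.remove) auto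
  also have "\<dots> \<le> (F m (\<alpha> m) * (\<Sum>j<k. \<Sum>i<j. (cmod (w i - w j))\<^sup>2))
      * (\<Prod>j\<in>{..<J} - {m}. F j (\<alpha> j))"
    using Fv F0 m zm
    by (intro mult_mono prod_mono mult_nonneg_nonneg sum_nonneg prod_nonneg) (auto simp: z_def)
  also have "\<dots> = (\<Prod>j<J. F j (\<alpha> j)) * (\<Sum>j<k. \<Sum>i<j. (cmod (w i - w j))\<^sup>2)"
    using m by (subst prod.remove[of "{..<J}" m]) (auto simp: mult_ac)
  finally show ?thesis by (simp add: v_def)
qed

theorem corollary9:
  fixes M :: "'a measure"
    and g :: "nat \<Rightarrow> 'a \<Rightarrow> complex \<Rightarrow> complex"
    and \<sigma> :: "nat \<Rightarrow> real"
    and J k :: nat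
    and S :: "complex set"
  assumes "prob_space M"
    and "J \<ge> 1"
    and "\<And>j. j < J \<Longrightarrow> \<sigma> j > 0"
    and "\<And>j. j < J \<Longrightarrow>
           gaussian_analytic_function M (g j) (\<lambda>u v. exp (complex_of_real (\<sigma> j) * u * v))"
    and "prob_space.indep_vars M (\<lambda>_. Pi\<^sub>M UNIV (\<lambda>_. borel)) g {..<J}"
    and "compact S"
    and "k > J"
  shows "\<exists>C>0. \<forall>w. (\<forall>i<k. w i \<in> S) \<and> inj_on w {..<k} \<longrightarrow>
           product_zero_density J (\<lambda>j. covariance_kernel M (g j)) k w
             \<le> C * (\<Sum>j<k. \<Sum>i<j. (cmod (w i - w j))\<^sup>2)"
proof -
  let ?K = "\<lambda>j. covariance_kernel M (g j)"
  \<comment> \<open>The densities see the random functions through their kernels, which are the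
    given exponentials.\<close>
  have K: "?K j = (\<lambda>u v. exp (complex_of_real (\<sigma> j) * u * v))" if "j < J" for j
    using assms(4)[OF that] by (intro ext) (auto simp: gaussian_analytic_function_def)
  obtain R0 where "\<forall>z\<in>S. cmod z \<le> R0"
    using compact_imp_bounded[OF \<open>compact S\<close>] by (auto simp: bounded_iff)
  \<comment> \<open>Enlarging the radius to at least 1 meets the requirement of the interpolation
    bounds.\<close>
  then obtain R where "R \<ge> 1" and R: "\<And>z. z \<in> S \<Longrightarrow> cmod z \<le> R"
    by (metis max.cobounded1 max.coboundedI2)
  \<comment> \<open>Choosing a constant for each \<open>j\<close> and \<open>r\<close> gives a
    function \<open>F\<close> that is fixed before the points are.\<close>
  define good where "good = (\<lambda>j r C. C \<ge> 0 \<and> (\<forall>w. inj_on w {..<r} \<and> (\<forall>i<r. cmod (w i) \<le> R) \<longrightarrow>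
      \<bar>zero_density (?K j) r w\<bar> \<le> C \<and>
      (2 \<le> r \<longrightarrow> \<bar>zero_density (?K j) r w\<bar> \<le> C * (cmod (w 1 - w 0))\<^sup>2)))"
  define F where "F = (\<lambda>j r. SOME C. good j r C)"
  have F: "good j r (F j r)" if "j < J" for j r
  proof -
    have "\<exists>C. good j r C"
      using zero_density_exp_kernel_repulsion[OF assms(3)[OF that] \<open>R \<ge> 1\<close>, of r]
      unfolding good_def K[OF that] by blast
    thus ?thesis unfolding F_def by (rule someI_ex)
  qed
  let ?I = "{\<alpha>. \<alpha> \<in> {..<J} \<rightarrow>\<^sub>E (UNIV :: nat set) \<and> (\<Sum>j<J. \<alpha> j) = k}"
  define \<rho> where "\<rho> = (\<lambda>\<alpha> :: nat \<Rightarrow> nat. 1 / real (\<Prod>j<J. fact (\<alpha> j)))"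
  have \<rho>: "\<rho> \<alpha> \<ge> 0" for \<alpha> unfolding \<rho>_def by (simp add: prod_nonneg)
  define C where "C = (\<Sum>\<alpha>\<in>?I. \<Sum>\<tau> | \<tau> permutes {..<k}. \<rho> \<alpha> * (\<Prod>j<J. F j (\<alpha> j)))"
  have "C \<ge> 0"
    unfolding C_def using \<rho> F
    by (intro sum_nonneg mult_nonneg_nonneg prod_nonneg) (auto simp: good_def)
  show ?thesis
  \<comment> \<open>\<open>C\<close> is only known to be nonnegative, so 1 is added to obtain a
    positive constant.\<close>
  proof (intro exI[of _ "C + 1"] conjI allI impI; (elim conjE)?)
    show "C + 1 > 0" using \<open>C \<ge> 0\<close> by simp
    fix w :: "nat \<Rightarrow> complex"
    assume w: "\<forall>i<k. w i \<in> S" and inj: "inj_on w {..<k}"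
    let ?D = "\<Sum>j<k. \<Sum>i<j. (cmod (w i - w j))\<^sup>2"
    have "product_zero_density J ?K k w = (\<Sum>\<alpha>\<in>?I. \<Sum>\<tau> | \<tau> permutes {..<k}.
        \<rho> \<alpha> * (\<Prod>j<J. zero_density (?K j) (\<alpha> j) (\<lambda>i. w (\<tau> ((\<Sum>l<j. \<alpha> l) + i)))))"
      by (simp only: product_zero_density_def \<rho>_def)
    also have "\<dots> \<le> (\<Sum>\<alpha>\<in>?I. \<Sum>\<tau> | \<tau> permutes {..<k}. \<rho> \<alpha> * ((\<Prod>j<J. F j (\<alpha> j)) * ?D))"
    proof (intro sum_mono mult_left_mono \<rho>)
      fix \<alpha> \<tau> assume "\<alpha> \<in> ?I" and "\<tau> \<in> {\<tau>. \<tau> permutes {..<k}}"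
      thus "(\<Prod>j<J. zero_density (?K j) (\<alpha> j) (\<lambda>i. w (\<tau> ((\<Sum>l<j. \<alpha> l) + i))))
          \<le> (\<Prod>j<J. F j (\<alpha> j)) * ?D"
        using w R inj F unfolding good_def
        by (intro prod_zero_density_repulsion[OF \<open>k > J\<close>, where R = R]) blast+
    qed
    also have "\<dots> = C * ?D"
      unfolding C_def by (simp add: sum_distrib_right mult.assoc)
    also have "\<dots> \<le> (C + 1) * ?D"
      by (intro mult_right_mono sum_nonneg) auto
    finally show "product_zero_density J ?K k w \<le> (C + 1) * ?D" .
  qed
qed

end
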